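(* For all integers $n \ge 0$, $$P_n + N_n = (-1, 2).$$
   Context: The sequences $\{P_n\}_{n\ge 0}$ (positive orbit) and $\{N_n\}_{n\ge 0}$ (negative orbit) of points of $\mathbb{Z}^2$ are defined by the recurrences $$P_{n+1} = A P_n + v,\quad P_0 = (0,0), \qquad N_{n+1} = A N_n,\quad N_0 = (-1,2),$$ where $A = \begin{pmatrix} 1 & -1 \\ 1 & 1 \end{pmatrix}$ and $v = (2,1)$, with points treated as column vectors. Identifying $(x,y)\in\mathbb{R}^2$ with $x+iy\in\mathbb{C}$, these read $P_{n+1} = (1+i)P_n + (2+i)$ with $P_0 = 0$, and $N_{n+1} = (1+i)N_n$ with $N_0 = -1+2i$. *)

theory Defs
  imports "HOL-Analysis.Analysis"
begin

(* The matrix is given by its rows; points of the integer lattice are column vectors. *)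

definition A :: "int ^ 2 ^ 2" where
  "A = vector [vector [1, -1], vector [1, 1]]"

definition v :: "int ^ 2" where
  "v = vector [2, 1]"

primrec P :: "nat \<Rightarrow> int ^ 2" where
  "P 0 = vector [0, 0]"
| "P (Suc n) = (A *v P n) + v"

primrec N :: "nat \<Rightarrow> int ^ 2" where
  "N 0 = vector [-1, 2]"
| "N (Suc n) = A *v N n"

end

theory Submission
  imports Defs
begin

text \<open>The two orbits satisfy the same recurrence except for the translation \<open>v\<close>, which occurs
  in only one of them. By linearity of \<open>A\<close>, their sum therefore follows the affine map
  \<open>w \<mapsto> A w + v\<close>. It starts at \<open>(-1, 2)\<close>, which is the fixed point of this map
  (in complex terms, the solution \<open>-1 + 2i\<close> of \<open>z = (1 + i) z + (2 + i)\<close>), and so it never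
  moves.\<close>

lemma affine_map_fixed_point: "A *v vector [-1, 2] + v = vector [-1, 2]"
  by (simp add: A_def v_def vec_eq_iff forall_2 matrix_vector_mult_def sum_2)

theorem theorem5p1:
  fixes n :: nat
  shows "P n + N n = vector [-1, 2]"
proof (induction n)
  case 0
  show ?case by (simp add: vec_eq_iff forall_2)
next
  case (Suc n)
  have "P (Suc n) + N (Suc n) = A *v (P n + N n) + v"
    by (simp add: matrix_vector_right_distrib)
  also have "\<dots> = vector [-1, 2]"
    by (simp only: Suc.IH affine_map_fixed_point)
  finally show ?case .
qed

end
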